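(* Assume that $\mathcal{A} = (Q,q_0,\delta,F)$ is a linear weak alternating automaton (LWAA). Then $\mathcal{L}(\mathcal{A}) \neq \emptyset$ if and only if there exists a finite run dag $\Delta = e_0 e_1 \ldots e_n$ with configurations $c_0 c_1 \ldots c_{n+1}$ over a finite sequence $s_0 \ldots s_n$ of states and some $k \leq n$ such that (1) $c_k = c_{n+1}$, and (2) for every $q \in F$, one has $(q,q) \notin e_j$ for some $j$ where $k \leq j \leq n$.
   Context: Fix a finite set $\mathcal{V}$ of atomic propositions; a state is a subset $s \subseteq \mathcal{V}$, and a temporal structure is a sequence $\sigma = s_0 s_1 \ldots$ of states. A set is identified with the Boolean valuation making true exactly its elements. An alternating $\omega$-automaton $\mathcal{A} = (Q, q_0, \delta, Acc)$ has a finite set of locations $Q$ with $Q \cap \mathcal{V} = \emptyset$, an initial location $q_0 \in Q$, a transition function $\delta$ assigning to each $q \in Q$ a propositional formula $\delta(q)$ over $Q \cup \mathcal{V}$ in which locations occur only positively, and an acceptance condition $Acc \subseteq Q^{\omega}$. Write $q \rightarrow q'$ if $q'$ appears in $\delta(q)$. For a relation $r$, $\mathrm{dom}(r)$ is its domain and $r(A)$ the image of $A$ (with $r(x) = r(\{x\})$). A run dag of $\mathcal{A}$ over $\sigma = s_0 s_1 \ldots$ is a sequence $\Delta = e_0 e_1 \ldots$ of edge sets $e_i \subseteq Q \times Q$, with configurations $c_0 = \{q_0\}$ and $c_{i+1} = e_i(c_i)$, such that for all $i$, $\mathrm{dom}(e_i) \subseteq c_i$ and for all $q \in c_i$ the valuation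 $s_i \cup e_i(q)$ satisfies $\delta(q)$; a finite run dag is a finite prefix of a run dag. A path is a sequence $p_0 p_1 \ldots$ with $p_0 = q_0$ and $(p_i,p_{i+1}) \in e_i$. A run dag is accepting iff every infinite path lies in $Acc$, and $\mathcal{L}(\mathcal{A})$ is the set of temporal structures admitting an accepting run dag. A (co-Büchi) linear weak alternating automaton (LWAA) $\mathcal{A} = (Q,q_0,\delta,F)$ is such an automaton with $F \subseteq Q$, where the relation $q' \preceq_{\mathcal{A}} q$ iff $q \rightarrow^* q'$ is a partial order on $Q$, and $Acc$ is the set of sequences $p_0 p_1 \ldots \in Q^{\omega}$ with $p_i \in F$ for only finitely many $i$. *)

theory Defs
  imports Main
begin

(* Locations and atomic propositions share one type 'a; the locations Q and the
   propositions V are disjoint sets of elements of this type. *)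

datatype (atoms: 'a) form =
    TT
  | FF
  | Atom 'a
  | Neg "'a form"
  | And "'a form" "'a form"
  | Or "'a form" "'a form"
  | Imp "'a form" "'a form"

(* A set of type "'a set" is read as the valuation making exactly its elements true. *)
primrec sat :: "'a set \<Rightarrow> 'a form \<Rightarrow> bool" (infix "\<Turnstile>" 50) where
  "M \<Turnstile> TT \<longleftrightarrow> True"
| "M \<Turnstile> FF \<longleftrightarrow> False"
| "M \<Turnstile> Atom a \<longleftrightarrow> a \<in> M"
| "M \<Turnstile> Neg f \<longleftrightarrow> \<not> M \<Turnstile> f"
| "M \<Turnstile> And f g \<longleftrightarrow> M \<Turnstile> f \<and> M \<Turnstile> g"
| "M \<Turnstile> Or f g \<longleftrightarrow> M \<Turnstile> f \<or> M \<Turnstile> g"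
| "M \<Turnstile> Imp f g \<longleftrightarrow> (M \<Turnstile> f \<longrightarrow> M \<Turnstile> g)"

(* "occ True f" are the atoms with a positive occurrence in f (below an even number of
   negations, the left side of an implication counting as one), "occ False f" those with a
   negative occurrence. *)
primrec occ :: "bool \<Rightarrow> 'a form \<Rightarrow> 'a set" where
  "occ b TT = {}"
| "occ b FF = {}"
| "occ b (Atom a) = (if b then {a} else {})"
| "occ b (Neg f) = occ (\<not> b) f"
| "occ b (And f g) = occ b f \<union> occ b g"
| "occ b (Or f g) = occ b f \<union> occ b g"
| "occ b (Imp f g) = occ (\<not> b) f \<union> occ b g"

definition temporal_structure :: "'a set \<Rightarrow> (nat \<Rightarrow> 'a set) \<Rightarrow> bool" where
  "temporal_structure V \<sigma> \<longleftrightarrow> (\<forall>i. \<sigma> i \<subseteq> V)"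

record 'a automaton =
  locs :: "'a set"
  init :: 'a
  trans :: "'a \<Rightarrow> 'a form"
  acc :: "(nat \<Rightarrow> 'a) set"

(* Values of "trans A" outside "locs A" are irrelevant. *)
definition alternating_automaton :: "'a set \<Rightarrow> 'a automaton \<Rightarrow> bool" where
  "alternating_automaton V A \<longleftrightarrow>
     finite (locs A) \<and> locs A \<inter> V = {} \<and> init A \<in> locs A \<and>
     (\<forall>q\<in>locs A. atoms (trans A q) \<subseteq> locs A \<union> V \<and> occ False (trans A q) \<inter> locs A = {}) \<and>
     acc A \<subseteq> {p. \<forall>i. p i \<in> locs A}"

definition succ_rel :: "'a automaton \<Rightarrow> 'a rel" where
  "succ_rel A = {(q, q'). q \<in> locs A \<and> q' \<in> locs A \<and> q' \<in> atoms (trans A q)}"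

primrec config :: "'a automaton \<Rightarrow> (nat \<Rightarrow> 'a rel) \<Rightarrow> nat \<Rightarrow> 'a set" where
  "config A e 0 = {init A}"
| "config A e (Suc i) = e i `` config A e i"

definition run_dag :: "'a automaton \<Rightarrow> (nat \<Rightarrow> 'a set) \<Rightarrow> (nat \<Rightarrow> 'a rel) \<Rightarrow> bool" where
  "run_dag A \<sigma> e \<longleftrightarrow>
     (\<forall>i. e i \<subseteq> locs A \<times> locs A \<and> Domain (e i) \<subseteq> config A e i \<and>
          (\<forall>q \<in> config A e i. \<sigma> i \<union> e i `` {q} \<Turnstile> trans A q))"

definition finite_run_dag :: "'a set \<Rightarrow> 'a automaton \<Rightarrow> 'a set list \<Rightarrow> 'a rel list \<Rightarrow> bool" where
  "finite_run_dag V A ss es \<longleftrightarrow>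
     (\<exists>\<sigma> e. temporal_structure V \<sigma> \<and> run_dag A \<sigma> e \<and>
            ss = map \<sigma> [0..<length es] \<and> es = map e [0..<length es])"

definition infinite_path :: "'a automaton \<Rightarrow> (nat \<Rightarrow> 'a rel) \<Rightarrow> (nat \<Rightarrow> 'a) \<Rightarrow> bool" where
  "infinite_path A e p \<longleftrightarrow> p 0 = init A \<and> (\<forall>i. (p i, p (Suc i)) \<in> e i)"

definition accepting :: "'a automaton \<Rightarrow> (nat \<Rightarrow> 'a rel) \<Rightarrow> bool" where
  "accepting A e \<longleftrightarrow> (\<forall>p. infinite_path A e p \<longrightarrow> p \<in> acc A)"

definition language :: "'a set \<Rightarrow> 'a automaton \<Rightarrow> (nat \<Rightarrow> 'a set) set" where
  "language V A =
     {\<sigma>. temporal_structure V \<sigma> \<and> (\<exists>e. run_dag A \<sigma> e \<and> accepting A e)}"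

definition cobuchi :: "'a set \<Rightarrow> 'a \<Rightarrow> ('a \<Rightarrow> 'a form) \<Rightarrow> 'a set \<Rightarrow> 'a automaton" where
  "cobuchi Q q0 \<delta> F =
     \<lparr>locs = Q, init = q0, trans = \<delta>, acc = {p. (\<forall>i. p i \<in> Q) \<and> finite {i. p i \<in> F}}\<rparr>"

definition LWAA :: "'a set \<Rightarrow> 'a set \<Rightarrow> 'a \<Rightarrow> ('a \<Rightarrow> 'a form) \<Rightarrow> 'a set \<Rightarrow> bool" where
  "LWAA V Q q0 \<delta> F \<longleftrightarrow>
     alternating_automaton V (cobuchi Q q0 \<delta> F) \<and> F \<subseteq> Q \<and>
     partial_order_on Q
       {(q', q). q \<in> Q \<and> q' \<in> Q \<and> (q, q') \<in> (succ_rel (cobuchi Q q0 \<delta> F))\<^sup>*}"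

end

(* For the forward direction, some configuration recurs infinitely often because there are only
   finitely many of them, and no self-loop at a location of F persists forever, since it would
   give a rejecting path; so a long enough segment between two recurrences fulfils (2).
   Conversely, unroll the lasso. A run dag may contain edges (q, q') where q' does not appear in
   the transition formula of q, and with such edges the unrolled run dag need not be accepting.
   Deleting them preserves satisfaction of the transition formulas and only shrinks the
   configurations, and the remaining paths descend in the partial order, so they are eventually
   constant; by (2) the limit cannot be in F. *)

theory Submission
  imports Defs "HOL-Library.Infinite_Set"
begin

text \<open>This is what permits deleting edges to locations that do not appear in the formula of
  their source.\<close>

lemma sat_cong_atoms:
  "M \<inter> atoms f = N \<inter> atoms f \<Longrightarrow> M \<Turnstile> f \<longleftrightarrow> N \<Turnstile> f"
proof (induction f)
  case (And f g)
  then have "M \<inter> atoms f = N \<inter> atoms f" "M \<inter> atoms g = N \<inter> atoms g" by auto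
  with And.IH show ?case by simp
next
  case (Or f g)
  then have "M \<inter> atoms f = N \<inter> atoms f" "M \<inter> atoms g = N \<inter> atoms g" by auto
  with Or.IH show ?case by simp
next
  case (Imp f g)
  then have "M \<inter> atoms f = N \<inter> atoms f" "M \<inter> atoms g = N \<inter> atoms g" by auto
  with Imp.IH show ?case by simp
qed auto

lemma config_cong:
  "(\<And>j. j < i \<Longrightarrow> e j = e' j) \<Longrightarrow> config A e i = config A e' i"
  by (induction i) auto

lemma config_subset_locs:
  assumes "init A \<in> locs A" and "\<And>i. e i \<subseteq> locs A \<times> locs A"
  shows "config A e i \<subseteq> locs A"
  using assms by (cases i) auto

lemma config_path:
  assumes "q \<in> config A e k"
  shows "\<exists>p. p 0 = init A \<and> p k = q \<and> (\<forall>i<k. (p i, p (Suc i)) \<in> e i)"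
  using assms
proof (induction k arbitrary: q)
  case 0
  then show ?case by (auto intro: exI[of _ "\<lambda>_. init A"])
next
  case (Suc k)
  then obtain q' where q': "q' \<in> config A e k" "(q', q) \<in> e k" by auto
  from Suc.IH[OF q'(1)] obtain p
    where p: "p 0 = init A" "p k = q'" "\<forall>i<k. (p i, p (Suc i)) \<in> e i" by blast
  have "\<forall>i<Suc k. ((p(Suc k := q)) i, (p(Suc k := q)) (Suc i)) \<in> e i"
    using p q' by (auto simp: less_Suc_eq)
  with p(1) show ?case by (intro exI[of _ "p(Suc k := q)"]) simp
qed

text \<open>The domain condition on \<open>e k\<close> forces \<open>q\<close> into the
  configuration at \<open>k\<close>, so some finite path from the initial location ends in
  \<open>q\<close>; from there the path stays at \<open>q\<close>.\<close>

lemma self_loops_infinite_path: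
  assumes "run_dag A \<sigma> e" and loop: "\<And>j. k \<le> j \<Longrightarrow> (q, q) \<in> e j"
  shows "\<exists>p. infinite_path A e p \<and> (\<forall>i\<ge>k. p i = q)"
proof -
  have "Domain (e k) \<subseteq> config A e k" using assms(1) by (auto simp: run_dag_def)
  with loop[of k] have "q \<in> config A e k" by blast
  from config_path[OF this] obtain p
    where p: "p 0 = init A" "p k = q" "\<forall>i<k. (p i, p (Suc i)) \<in> e i" by blast
  let ?p = "\<lambda>i. if i < k then p i else q"
  have "(?p i, ?p (Suc i)) \<in> e i" for i
  proof (cases "i < k")
    case True
    \<comment> \<open>At the seam \<open>Suc i = k\<close> both sides are \<open>q\<close>.\<close>
    then have "?p (Suc i) = p (Suc i)" using p(2) by (cases "Suc i = k") auto
    with True p(3) show ?thesis by simp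
  next
    case False
    with loop show ?thesis by simp
  qed
  then have "infinite_path A e ?p" using p by (auto simp: infinite_path_def)
  then show ?thesis by (intro exI[of _ ?p]) simp
qed

lemma accepting_self_loop_breaks:
  assumes "run_dag (cobuchi Q q0 \<delta> F) \<sigma> e" and "accepting (cobuchi Q q0 \<delta> F) e" and "q \<in> F"
  shows "\<exists>j\<ge>k. (q, q) \<notin> e j"
proof (rule ccontr)
  assume "\<not> ?thesis"
  then have "\<And>j. k \<le> j \<Longrightarrow> (q, q) \<in> e j" by blast
  from self_loops_infinite_path[OF assms(1) this] obtain p
    where p: "infinite_path (cobuchi Q q0 \<delta> F) e p" "\<forall>i\<ge>k. p i = q" by blast
  have "p \<in> acc (cobuchi Q q0 \<delta> F)" using p(1) assms(2) unfolding accepting_def by blast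
  then have "finite {i. p i \<in> F}" by (simp add: cobuchi_def)
  moreover have "{k..} \<subseteq> {i. p i \<in> F}" using p(2) assms(3) by auto
  ultimately show False using infinite_Ici by (auto dest: finite_subset)
qed

text \<open>Pigeonhole, applied both to configurations, as elements of \<open>Pow Q\<close>, and to
  the locations along a path.\<close>

lemma infinitely_recurring_value:
  fixes f :: "nat \<Rightarrow> 'b"
  assumes "finite B" and "\<And>i. f i \<in> B"
  shows "\<exists>i. infinite {j. f j = f i}"
proof -
  have "finite (range f)" using assms by (meson finite_subset image_subsetI)
  from pigeonhole_infinite[OF infinite_UNIV_nat this] show ?thesis by auto
qed

lemma nonempty_imp_lasso:
  fixes Q F :: "'a set" and q0 :: 'a and \<delta> :: "'a \<Rightarrow> 'a form"
  defines "A \<equiv> cobuchi Q q0 \<delta> F"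
  assumes "finite Q" "q0 \<in> Q" "F \<subseteq> Q" and run: "run_dag A \<sigma> e" and acc: "accepting A e"
  shows "\<exists>n k. k \<le> n \<and> config A e k = config A e (Suc n) \<and>
    (\<forall>q\<in>F. \<exists>j. k \<le> j \<and> j \<le> n \<and> (q, q) \<notin> e j)"
proof -
  have sub: "config A e i \<in> Pow Q" for i
    using config_subset_locs[of A e i] assms(3) run by (auto simp: A_def cobuchi_def run_dag_def)
  obtain k where k: "infinite {j. config A e j = config A e k}"
    using infinitely_recurring_value[of "Pow Q" "config A e"] sub assms(2) by auto
  have "\<forall>q\<in>F. \<exists>j\<ge>k. (q, q) \<notin> e j"
    using accepting_self_loop_breaks[OF run[unfolded A_def] acc[unfolded A_def]] by simp
  \<comment> \<open>\<open>b q\<close> is a time from \<open>k\<close> on at which the self-loop at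
    \<open>q\<close> is missing; as \<open>F\<close> is finite, one \<open>N\<close> bounds all
    these times.\<close>
  then obtain b where b: "\<And>q. q \<in> F \<Longrightarrow> k \<le> b q \<and> (q, q) \<notin> e (b q)" by metis
  have "finite (b ` F)" using assms(2,4) by (auto intro: finite_subset)
  then obtain N where N: "\<And>q. q \<in> F \<Longrightarrow> b q \<le> N" by (meson finite_nat_set_iff_bounded_le imageI)
  \<comment> \<open>A recurrence beyond both \<open>k\<close> and \<open>N\<close>. The segment ends
    at the predecessor \<open>n\<close> of \<open>m\<close>, and strictness gives
    \<open>k \<le> n\<close> and \<open>N \<le> n\<close>.\<close>
  obtain m where m: "max k N < m" "config A e m = config A e k"
    using k unfolding infinite_nat_iff_unbounded by blast
  then obtain n where n: "m = Suc n" by (cases m) auto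
  have "k \<le> b q \<and> b q \<le> n \<and> (q, q) \<notin> e (b q)" if "q \<in> F" for q
    using b[OF that] N[OF that] m(1) n by simp
  moreover have "k \<le> n" "config A e k = config A e (Suc n)" using m n by auto
  ultimately show ?thesis by blast
qed

text \<open>The configuration at \<open>i\<close> depends only on edge sets before \<open>i\<close>,
  so \<open>i = m\<close> is still covered although \<open>es ! m\<close> is out of range.\<close>

lemma finite_run_dag_config_nth:
  assumes "es = map e [0..<m]" and "i \<le> m"
  shows "config A (nth es) i = config A e i"
  by (rule config_cong) (use assms in auto)

text \<open>The position in the lasso at time \<open>i\<close>: a stem \<open>0, ..., k - 1\<close>,
  then the loop \<open>k, ..., n\<close> of length \<open>Suc (n - k)\<close> repeated
  forever.\<close>

definition lasso_index :: "nat \<Rightarrow> nat \<Rightarrow> nat \<Rightarrow> nat" where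
  "lasso_index k n i = (if i < k then i else k + (i - k) mod Suc (n - k))"

lemma lasso_index_0: "k \<le> n \<Longrightarrow> lasso_index k n 0 = 0"
  by (simp add: lasso_index_def)

lemma lasso_index_Suc:
  assumes "k \<le> n"
  shows "lasso_index k n (Suc i) = (if lasso_index k n i = n then k else Suc (lasso_index k n i))"
proof (cases "i < k")
  case True
  then show ?thesis using assms by (cases "Suc i = k") (auto simp: lasso_index_def)
next
  case False
  \<comment> \<open>Matches the wrap-around test of \<open>mod_Suc\<close> with arrival at the last
    loop position \<open>n\<close>.\<close>
  have "k + r = n \<longleftrightarrow> r = n - k" for r using assms by auto
  with False show ?thesis by (auto simp: lasso_index_def mod_Suc Suc_diff_le)
qed

lemma lasso_index_surj:
  assumes "k \<le> j" "j \<le> n"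
  shows "\<exists>i\<ge>m. lasso_index k n i = j"
proof -
  \<comment> \<open>Adding \<open>m\<close> full turns keeps the loop position \<open>j\<close> and,
    each turn having length at least 1, moves the time past \<open>m\<close>.\<close>
  let ?i = "j + m * Suc (n - k)"
  have "?i - k = (j - k) + m * Suc (n - k)" using assms by simp
  then have "(?i - k) mod Suc (n - k) = j - k"
    using assms by (simp only: mod_mult_self1) (simp add: diff_le_mono less_Suc_eq_le)
  then have "lasso_index k n ?i = j" using assms by (simp add: lasso_index_def)
  moreover have "m \<le> ?i" by simp
  ultimately show ?thesis by blast
qed

text \<open>The only critical step is the jump from \<open>n\<close> back to \<open>k\<close>, where
  the two configurations coincide by assumption. There is inclusion only, because \<open>h\<close>
  may omit edges.\<close>

lemma config_lasso:
  assumes "k \<le> n" "config A e k = config A e (Suc n)"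
    and "\<And>i. h i \<subseteq> e (lasso_index k n i)"
  shows "config A h i \<subseteq> config A e (lasso_index k n i)"
proof (induction i)
  case 0
  then show ?case using assms(1) by (simp add: lasso_index_0)
next
  case (Suc i)
  have "config A h (Suc i) \<subseteq> config A e (Suc (lasso_index k n i))"
    using Suc assms(3)[of i] by auto
  also have "\<dots> = config A e (lasso_index k n (Suc i))"
    using assms(1,2) by (simp add: lasso_index_Suc)
  finally show ?case .
qed

text \<open>Deleting edges can shrink configurations and so violate the domain condition of run
  dags; cutting away edges with unreachable sources restores it without further loss.\<close>

lemma config_restrict_reachable:
  "config A (\<lambda>i. h i \<inter> config A h i \<times> UNIV) j = config A h j"
  by (induction j) auto

text \<open>Some value \<open>p m\<close> recurs infinitely often. Whatever lies between two of its
  occurrences is mutually reachable with it, hence equal to it by antisymmetry.\<close>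

lemma eventually_constant:
  assumes "finite Q" and "antisym {(q', q). q \<in> Q \<and> q' \<in> Q \<and> (q, q') \<in> R\<^sup>*}"
    and inQ: "\<And>i. p i \<in> Q" and step: "\<And>i. (p i, p (Suc i)) \<in> R"
  shows "\<exists>m. \<forall>i\<ge>m. p i = p m"
proof -
  obtain m where m: "infinite {j. p j = p m}"
    using infinitely_recurring_value[of Q p] assms by blast
  have chain: "(p i, p j) \<in> R\<^sup>*" if "i \<le> j" for i j
    using that by (induction j rule: dec_induct) (auto intro: step rtrancl_into_rtrancl)
  have "p i = p m" if "m \<le> i" for i
  proof -
    obtain j where "i < j" "p j = p m" using m by (auto simp: infinite_nat_iff_unbounded)
    then have "(p m, p i) \<in> R\<^sup>*" "(p i, p m) \<in> R\<^sup>*"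
      using chain[OF that] chain[of i j] by auto
    with assms(2) inQ show ?thesis by (auto simp: antisym_def)
  qed
  then show ?thesis by blast
qed

lemma lasso_imp_nonempty:
  fixes Q F :: "'a set" and q0 :: 'a and \<delta> :: "'a \<Rightarrow> 'a form"
  defines "A \<equiv> cobuchi Q q0 \<delta> F"
  assumes lwaa: "LWAA V Q q0 \<delta> F" and \<sigma>: "temporal_structure V \<sigma>" and run: "run_dag A \<sigma> e"
    and "k \<le> n" and cyc: "config A e k = config A e (Suc n)"
    and brk: "\<forall>q\<in>F. \<exists>j. k \<le> j \<and> j \<le> n \<and> (q, q) \<notin> e j"
  shows "language V A \<noteq> {}"
proof -
  let ?f = "lasso_index k n"
  \<comment> \<open>\<open>h\<close> unrolls the lasso and keeps only edges to locations appearing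
    in the formula of the source; \<open>d\<close> also drops edges whose source became
    unreachable.\<close>
  define h where "h i = e (?f i) \<inter> succ_rel A" for i
  define d where "d = (\<lambda>i. h i \<inter> config A h i \<times> UNIV)"
  have Q: "finite Q" "q0 \<in> Q" and [simp]: "locs A = Q" "init A = q0" "trans A = \<delta>"
    using lwaa by (auto simp: LWAA_def alternating_automaton_def cobuchi_def A_def)
  have e: "\<And>i. e i \<subseteq> Q \<times> Q" "\<And>i q. q \<in> config A e i \<Longrightarrow> \<sigma> i \<union> e i `` {q} \<Turnstile> \<delta> q"
    using run by (auto simp: run_dag_def)
  have cd: "config A d i = config A h i" for i
    unfolding d_def by (rule config_restrict_reachable)
  have ch: "config A h i \<subseteq> config A e (?f i)" for i
    by (rule config_lasso) (use assms in \<open>auto simp: h_def\<close>)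
  have "\<sigma> (?f i) \<union> d i `` {q} \<Turnstile> \<delta> q" if q: "q \<in> config A h i" for i q
  proof -
    have "q \<in> config A e (?f i)" using q ch by blast
    from e(2)[OF this] have "\<sigma> (?f i) \<union> e (?f i) `` {q} \<Turnstile> \<delta> q" .
    \<comment> \<open>An edge of \<open>e\<close> from \<open>q\<close> to an atom of
      \<open>\<delta> q\<close> lies in \<open>succ_rel A\<close>, and \<open>q\<close> is
      reachable, so \<open>d\<close> keeps it.\<close>
    moreover have "(\<sigma> (?f i) \<union> e (?f i) `` {q}) \<inter> atoms (\<delta> q)
        = (\<sigma> (?f i) \<union> d i `` {q}) \<inter> atoms (\<delta> q)"
      using q e(1)[of "?f i"] by (auto simp: d_def h_def succ_rel_def)
    ultimately show ?thesis using sat_cong_atoms by blast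
  qed
  then have "run_dag A (\<sigma> \<circ> ?f) d"
    using e(1) by (auto simp: run_dag_def cd) (auto simp: d_def h_def succ_rel_def)
  moreover have "accepting A d"
    unfolding accepting_def
  proof (intro allI impI)
    fix p assume "infinite_path A d p"
    then have step: "(p i, p (Suc i)) \<in> succ_rel A" "(p i, p (Suc i)) \<in> e (?f i)" for i
      by (auto simp: infinite_path_def d_def h_def)
    then have pQ: "p i \<in> Q" for i using step(1)[of i] by (simp add: succ_rel_def)
    have "antisym {(q', q). q \<in> Q \<and> q' \<in> Q \<and> (q, q') \<in> (succ_rel A)\<^sup>*}"
      using lwaa by (simp add: LWAA_def A_def partial_order_on_def)
    from eventually_constant[where p = p, OF Q(1) this pQ step(1)]
    obtain m where m: "\<And>i. m \<le> i \<Longrightarrow> p i = p m" by blast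
    have "p m \<notin> F"
    proof
      assume "p m \<in> F"
      with brk obtain j where j: "k \<le> j" "j \<le> n" "(p m, p m) \<notin> e j" by blast
      \<comment> \<open>The loop returns to position \<open>j\<close> after the path has become
        constant, where the path would need the missing self-loop.\<close>
      then obtain i where "m \<le> i" "?f i = j" using lasso_index_surj by blast
      with step(2)[of i] m[of i] m[of "Suc i"] j(3) show False by simp
    qed
    then have "i < m" if "p i \<in> F" for i using m[of i] that by (cases "i < m") auto
    then have "finite {i. p i \<in> F}" by (auto intro: finite_subset[of _ "{..<m}"])
    with pQ show "p \<in> acc A" by (simp add: A_def cobuchi_def)
  qed
  moreover have "temporal_structure V (\<sigma> \<circ> ?f)"
    using \<sigma> by (simp add: temporal_structure_def)
  ultimately show ?thesis by (auto simp: language_def)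
qed

theorem theorem1:
  fixes V Q F :: "'a set" and q0 :: 'a and \<delta> :: "'a \<Rightarrow> 'a form"
  assumes "finite V" and "LWAA V Q q0 \<delta> F"
  shows "language V (cobuchi Q q0 \<delta> F) \<noteq> {} \<longleftrightarrow>
    (\<exists>n ss es k. length ss = Suc n \<and> length es = Suc n \<and>
       finite_run_dag V (cobuchi Q q0 \<delta> F) ss es \<and> k \<le> n \<and>
       config (cobuchi Q q0 \<delta> F) (nth es) k = config (cobuchi Q q0 \<delta> F) (nth es) (Suc n) \<and>
       (\<forall>q\<in>F. \<exists>j. k \<le> j \<and> j \<le> n \<and> (q, q) \<notin> es ! j))"
    (is "_ \<longleftrightarrow> ?lasso")
proof
  let ?A = "cobuchi Q q0 \<delta> F"
  assume "language V ?A \<noteq> {}"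
  then obtain \<sigma> e where run: "temporal_structure V \<sigma>" "run_dag ?A \<sigma> e" "accepting ?A e"
    by (auto simp: language_def)
  have "finite Q" "q0 \<in> Q" "F \<subseteq> Q"
    using assms(2) by (auto simp: LWAA_def alternating_automaton_def cobuchi_def)
  from nonempty_imp_lasso[OF this run(2,3)] obtain n k
    where nk: "k \<le> n" "config ?A e k = config ?A e (Suc n)"
      "\<forall>q\<in>F. \<exists>j. k \<le> j \<and> j \<le> n \<and> (q, q) \<notin> e j"
    by blast
  define ss where "ss = map \<sigma> [0..<Suc n]"
  define es where "es = map e [0..<Suc n]"
  have len: "length ss = Suc n" "length es = Suc n" by (simp_all add: ss_def es_def)
  have "finite_run_dag V ?A ss es"
    unfolding finite_run_dag_def len(2) using run ss_def es_def by blast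
  moreover have "config ?A (nth es) k = config ?A (nth es) (Suc n)"
    using nk by (simp only: finite_run_dag_config_nth[OF es_def] le_SucI order_refl)
  moreover have "es ! j = e j" if "j \<le> n" for j
    using that by (simp add: es_def del: upt_Suc)
  then have "\<forall>q\<in>F. \<exists>j. k \<le> j \<and> j \<le> n \<and> (q, q) \<notin> es ! j" using nk(3) by metis
  ultimately show ?lasso using len nk(1) by blast
next
  let ?A = "cobuchi Q q0 \<delta> F"
  assume ?lasso
  then obtain n ss es k where l: "length es = Suc n" "finite_run_dag V ?A ss es" "k \<le> n"
    "config ?A (nth es) k = config ?A (nth es) (Suc n)"
    "\<forall>q\<in>F. \<exists>j. k \<le> j \<and> j \<le> n \<and> (q, q) \<notin> es ! j"
    by blast
  \<comment> \<open>An infinite run dag extending the given prefix; the unrolling reads it only at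
    positions up to \<open>n\<close>.\<close>
  then obtain \<sigma> e where run: "temporal_structure V \<sigma>" "run_dag ?A \<sigma> e"
    and es: "es = map e [0..<Suc n]"
    by (auto simp: finite_run_dag_def simp del: upt_Suc)
  have cyc: "config ?A e k = config ?A e (Suc n)"
    using l(3,4) by (simp only: finite_run_dag_config_nth[OF es] le_SucI order_refl)
  have "es ! j = e j" if "j \<le> n" for j
    using that by (simp add: es del: upt_Suc)
  with l(5) have "\<forall>q\<in>F. \<exists>j. k \<le> j \<and> j \<le> n \<and> (q, q) \<notin> e j" by metis
  from lasso_imp_nonempty[OF assms(2) run l(3) cyc this] show "language V ?A \<noteq> {}" .
qed

end
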